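(* Let $n\ge 1$, let $\gamma: I\to\mathbb{E}^3$ be a unit-speed $(n+2)$-times differentiable regular curve with Frenet frame $\{T,N,B\}$, let $1\le k\le n$, and let $\gamma_k$ be the $k$-principal direction curve of $\gamma$, with Darboux vector $W_k$. If $\gamma$ is an $N_k$-slant helix and $\|W_k\|=\omega$ is constant, then $\gamma$ is a curve of $N_k$-constant precession.
   Context: $I\subset\mathbb{R}$ is an interval and $\mathbb{E}^3$ is Euclidean 3-space. For a unit-speed curve with nonvanishing second derivative, the Frenet frame is $T=\gamma'$, $N=\gamma''/\|\gamma''\|$, $B=T\times N$. Principal direction curves: let $\gamma_0(s)=\int T(s)\,ds$ be the tangent direction curve of $\gamma$ (a translate of $\gamma$, with frame $T_0=T$, $N_0=N$, $B_0=B$). Recursively for $1\le k\le n$, the $k$-principal direction curve of $\gamma$ is $\gamma_k(s)=\int N_{k-1}(s)\,ds$, where $N_{k-1}$ is the principal normal vector of $\gamma_{k-1}$. It is parametrized by the same arc-length parameter $s$ as $\gamma$ and has Frenet frame $T_k=N_{k-1}$, $N_k=N_{k-1}'/\|N_{k-1}'\|$, $B_k=T_k\times N_k$. It is assumed that $\gamma''\neq 0$ everywhere, so that these frames exist, and that the derivatives appearing in the Frenet equations exist and that $\kappa_k,\tau_k$ are differentiable. The curvature $\kappa_k>0$ and torsion $\tau_k$ of $\gamma_k$ are defined by the Frenet equations $T_k'=\kappa_kN_k$, $N_k'=-\kappa_kT_k+\tau_kB_k$, $B_k'=-\tau_kN_k$. The Darboux vector of $\gamma_k$ is $W_k=\tau_kT_k+\kappa_kB_k$.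 The curve $\gamma$ is an $N_k$-slant helix if the principal normal vector $N_k$ of $\gamma_k$ makes a constant angle with a fixed direction, i.e. there is a fixed unit vector $\vec u$ with $\langle N_k,\vec u\rangle$ constant. The curve $\gamma$ is a curve of $N_k$-constant precession if the Darboux vector $W_k$ of $\gamma_k$ makes a constant angle with a fixed direction and has constant speed, meaning constant length $\|W_k\|$. *)

theory Defs
  imports "HOL-Analysis.Analysis"
begin

text \<open>All derivatives are taken within the parameter interval \<open>I\<close>, hence one-sided at those
  endpoints that belong to \<open>I\<close>; curves are total functions of which only the values on \<open>I\<close> matter.\<close>

primrec times_differentiable_on ::
    "nat \<Rightarrow> (real \<Rightarrow> 'a::real_normed_vector) \<Rightarrow> real set \<Rightarrow> bool" where
  "times_differentiable_on 0 f I \<longleftrightarrow> True"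
| "times_differentiable_on (Suc m) f I \<longleftrightarrow>
     f differentiable_on I \<and>
     times_differentiable_on m (\<lambda>s. vector_derivative f (at s within I)) I"

text \<open>The Frenet frame. These formulas presuppose a unit-speed parametrization; the second one
  is meaningful where the derivative of the tangent does not vanish.\<close>

definition tangent :: "real set \<Rightarrow> (real \<Rightarrow> real^3) \<Rightarrow> real \<Rightarrow> real^3" where
  "tangent I \<gamma> s = vector_derivative \<gamma> (at s within I)"

definition principal_normal :: "real set \<Rightarrow> (real \<Rightarrow> real^3) \<Rightarrow> real \<Rightarrow> real^3" where
  "principal_normal I \<gamma> s =
     (let T' = vector_derivative (tangent I \<gamma>) (at s within I) in T' /\<^sub>R norm T')"

definition binormal :: "real set \<Rightarrow> (real \<Rightarrow> real^3) \<Rightarrow> real \<Rightarrow> real^3" where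
  "binormal I \<gamma> s = cross3 (tangent I \<gamma> s) (principal_normal I \<gamma> s)"

text \<open>Curvature and torsion are the coefficients in the Frenet equations
  \<open>T' = \<kappa> N\<close>, \<open>N' = - \<kappa> T + \<tau> B\<close>, \<open>B' = - \<tau> N\<close>; they are read off by pairing with the
  orthonormal frame (see \<open>frenet_equations_unique\<close> below).\<close>

definition curvature :: "real set \<Rightarrow> (real \<Rightarrow> real^3) \<Rightarrow> real \<Rightarrow> real" where
  "curvature I \<gamma> s =
     vector_derivative (tangent I \<gamma>) (at s within I) \<bullet> principal_normal I \<gamma> s"

definition torsion :: "real set \<Rightarrow> (real \<Rightarrow> real^3) \<Rightarrow> real \<Rightarrow> real" where
  "torsion I \<gamma> s =
     vector_derivative (principal_normal I \<gamma>) (at s within I) \<bullet> binormal I \<gamma> s"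

definition darboux :: "real set \<Rightarrow> (real \<Rightarrow> real^3) \<Rightarrow> real \<Rightarrow> real^3" where
  "darboux I \<gamma> s = torsion I \<gamma> s *\<^sub>R tangent I \<gamma> s + curvature I \<gamma> s *\<^sub>R binormal I \<gamma> s"

definition frenet_differentiable_on :: "(real \<Rightarrow> real^3) \<Rightarrow> real set \<Rightarrow> bool" where
  "frenet_differentiable_on \<gamma> I \<longleftrightarrow>
     tangent I \<gamma> differentiable_on I \<and> principal_normal I \<gamma> differentiable_on I \<and>
     binormal I \<gamma> differentiable_on I \<and>
     curvature I \<gamma> differentiable_on I \<and> torsion I \<gamma> differentiable_on I"

text \<open>The indefinite integral: an arbitrary primitive on \<open>I\<close>. The integration constant
  affects neither the Frenet frame nor anything derived from it.\<close>

definition primitive :: "real set \<Rightarrow> (real \<Rightarrow> real^3) \<Rightarrow> real \<Rightarrow> real^3" where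
  "primitive I f = (SOME F. \<forall>s\<in>I. (F has_vector_derivative f s) (at s within I))"

primrec principal_direction_curve ::
    "real set \<Rightarrow> (real \<Rightarrow> real^3) \<Rightarrow> nat \<Rightarrow> real \<Rightarrow> real^3" where
  "principal_direction_curve I \<gamma> 0 = primitive I (tangent I \<gamma>)"
| "principal_direction_curve I \<gamma> (Suc k) =
     primitive I (principal_normal I (principal_direction_curve I \<gamma> k))"

definition N_slant_helix :: "real set \<Rightarrow> (real \<Rightarrow> real^3) \<Rightarrow> nat \<Rightarrow> bool" where
  "N_slant_helix I \<gamma> k \<longleftrightarrow>
     (\<exists>u c. norm u = 1 \<and>
        (\<forall>s\<in>I. principal_normal I (principal_direction_curve I \<gamma> k) s \<bullet> u = c))"

definition vec_angle :: "real^3 \<Rightarrow> real^3 \<Rightarrow> real" where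
  "vec_angle v w = arccos (v \<bullet> w / (norm v * norm w))"

definition N_constant_precession :: "real set \<Rightarrow> (real \<Rightarrow> real^3) \<Rightarrow> nat \<Rightarrow> bool" where
  "N_constant_precession I \<gamma> k \<longleftrightarrow>
     (\<exists>u \<theta>. norm u = 1 \<and>
        (\<forall>s\<in>I. vec_angle (darboux I (principal_direction_curve I \<gamma> k) s) u = \<theta>)) \<and>
     (\<exists>\<omega>. \<forall>s\<in>I. norm (darboux I (principal_direction_curve I \<gamma> k) s) = \<omega>)"

lemma frenet_equations_unique:
  assumes nontriv: "at s within I \<noteq> bot"
    and T: "norm (tangent I \<gamma> s) = 1"
    and N: "norm (principal_normal I \<gamma> s) = 1"
    and TN: "tangent I \<gamma> s \<bullet> principal_normal I \<gamma> s = 0"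
    and T': "(tangent I \<gamma> has_vector_derivative \<kappa> *\<^sub>R principal_normal I \<gamma> s) (at s within I)"
    and N': "(principal_normal I \<gamma> has_vector_derivative
                - \<kappa> *\<^sub>R tangent I \<gamma> s + \<tau> *\<^sub>R binormal I \<gamma> s) (at s within I)"
  shows "curvature I \<gamma> s = \<kappa>" and "torsion I \<gamma> s = \<tau>"
proof -
  have "principal_normal I \<gamma> s \<bullet> principal_normal I \<gamma> s = 1"
    using N by (simp add: dot_square_norm)
  then show "curvature I \<gamma> s = \<kappa>"
    using vector_derivative_within[OF nontriv T'] by (simp add: curvature_def)
  have "(norm (binormal I \<gamma> s))\<^sup>2 = 1"
    using norm_cross_dot[of "tangent I \<gamma> s" "principal_normal I \<gamma> s"] T N TN
    unfolding binormal_def by simp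
  then have "binormal I \<gamma> s \<bullet> binormal I \<gamma> s = 1"
    by (simp add: power2_norm_eq_inner)
  moreover have "tangent I \<gamma> s \<bullet> binormal I \<gamma> s = 0"
    by (simp add: binormal_def dot_cross_self)
  ultimately show "torsion I \<gamma> s = \<tau>"
    using vector_derivative_within[OF nontriv N'] by (simp add: torsion_def inner_diff_left)
qed

lemma primitive_has_vector_derivative:
  fixes f :: "real \<Rightarrow> real^3"
  assumes I: "is_interval I" and f: "continuous_on I f" and s: "s \<in> I"
  shows "(primitive I f has_vector_derivative f s) (at s within I)"
proof -
  obtain s0 where s0: "s0 \<in> I" using s by blast
  define F where "F = (\<lambda>t. integral {s0..t} f - integral {t..s0} f)"
  have "(F has_vector_derivative f t) (at t within I)" if t: "t \<in> I" for t
  proof -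
    obtain a where a: "a \<in> I" "a \<le> t" "a \<le> s0" "a < t \<or> (\<forall>x\<in>I. t \<le> x)"
    proof (cases "\<exists>x\<in>I. x < t")
      case True
      then obtain x where "x \<in> I" "x < t" by blast
      then show thesis using that[of "min x s0"] s0 by (auto simp: min_def)
    next
      case False
      then show thesis using that[of t] t s0 by force
    qed
    obtain b where b: "b \<in> I" "t \<le> b" "s0 \<le> b" "t < b \<or> (\<forall>x\<in>I. x \<le> t)"
    proof (cases "\<exists>x\<in>I. t < x")
      case True
      then obtain x where "x \<in> I" "t < x" by blast
      then show thesis using that[of "max x s0"] s0 by (auto simp: max_def)
    next
      case False
      then show thesis using that[of t] t s0 by force
    qed
    have sub: "{a..b} \<subseteq> I"
      using I a b unfolding is_interval_1 by (meson atLeastAtMost_iff subsetI)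
    have cont: "continuous_on {a..b} f" using f sub continuous_on_subset by blast
    have int: "f integrable_on {x..y}" if "a \<le> x" "y \<le> b" for x y
      using that cont by (intro integrable_continuous_real) (auto intro: continuous_on_subset)
    have F: "F x = integral {a..x} f - integral {a..s0} f" if "x \<in> {a..b}" for x
    proof (cases "s0 \<le> x")
      case True
      moreover have "integral {x..s0} f = 0" using True by (cases "x = s0") auto
      ultimately show ?thesis
        using Henstock_Kurzweil_Integration.integral_combine[of a s0 x f] int[of a x] that a
        by (auto simp: F_def algebra_simps)
    next
      case False
      then show ?thesis
        using Henstock_Kurzweil_Integration.integral_combine[of a x s0 f] int[of a s0] that a b
        by (auto simp: F_def algebra_simps)
    qed
    have "((\<lambda>x. integral {a..x} f - integral {a..s0} f) has_vector_derivative f t - 0)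
            (at t within {a..b})"
      using a b by (intro derivative_intros integral_has_vector_derivative[OF cont]) auto
    then have "(F has_vector_derivative f t) (at t within {a..b})"
      by (simp, elim has_vector_derivative_transform[rotated 2]) (use a b F in auto)
    moreover have "at t within I = at t within {a..b}"
    proof (rule at_within_nhd[where S = "{(if a < t then a else t - 1)<..<(if t < b then b else t + 1)}"])
      show "I \<inter> {(if a < t then a else t - 1)<..<(if t < b then b else t + 1)} - {t} =
            {a..b} \<inter> {(if a < t then a else t - 1)<..<(if t < b then b else t + 1)} - {t}"
        using a b sub by (force split: if_splits)
    qed auto
    ultimately show ?thesis by simp
  qed
  then have "\<forall>t\<in>I. (F has_vector_derivative f t) (at t within I)" by blast
  then have "\<forall>t\<in>I. (primitive I f has_vector_derivative f t) (at t within I)"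
    unfolding primitive_def
    by (rule someI[where P = "\<lambda>F. \<forall>t\<in>I. (F has_vector_derivative f t) (at t within I)"])
  then show ?thesis using s by blast
qed

end

theory Submission
  imports Defs
begin

text \<open>
  Write \<open>T, N, B\<close> for the Frenet frame of the \<open>k\<close>-th principal direction curve and
  \<open>W = \<tau> T + \<kappa> B\<close> for its Darboux vector, and let \<open>u\<close> be the axis with \<open>\<langle>N, u\<rangle> = c\<close>.
  Differentiating this relation gives \<open>\<tau> \<langle>B, u\<rangle> - \<kappa> \<langle>T, u\<rangle> = 0\<close>: the vectors \<open>(\<tau>, \<kappa>)\<close> and
  \<open>(\<langle>T, u\<rangle>, \<langle>B, u\<rangle>)\<close> of the plane are parallel. Their inner product is \<open>\<langle>W, u\<rangle>\<close>, so the equality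
  case of the Cauchy--Schwarz inequality reads
  \<open>\<langle>W, u\<rangle>\<^sup>2 = (\<tau>\<^sup>2 + \<kappa>\<^sup>2) (\<langle>T, u\<rangle>\<^sup>2 + \<langle>B, u\<rangle>\<^sup>2) = \<omega>\<^sup>2 (1 - c\<^sup>2)\<close>.
  Hence the continuous function \<open>\<langle>W, u\<rangle>\<close> takes at most two values on the interval, and so it is
  constant; as \<open>\<parallel>W\<parallel>\<close> is constant, \<open>W\<close> makes a constant angle with the same axis \<open>u\<close>
  (lemma \<open>slant_helix_darboux_inner_constant\<close>).

  This argument needs \<open>T\<close> and \<open>N\<close> to be orthonormal. That holds because the construction of the
  principal direction curves never degenerates (lemma \<open>principal_direction_curve_regular\<close>):
  each step takes the principal normal as the new tangent, costs one derivative, and yields a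
  tangent with nonvanishing derivative, since \<open>\<langle>N', T\<rangle> = - \<langle>N, T'\<rangle> = - \<kappa> \<noteq> 0\<close>.
\<close>

section \<open>Iterated differentiability\<close>

text \<open>A nondegenerate interval has no isolated points, endpoints included; this is what makes
  derivatives within it unique.\<close>

lemma at_within_interval_nontrivial:
  fixes I :: "real set"
  assumes "is_interval I" and "\<exists>a\<in>I. \<exists>b\<in>I. a < b"
  shows "\<forall>s\<in>I. at s within I \<noteq> bot"
proof
  fix s assume "s \<in> I"
  from assms(2) have "\<nexists>x. I = {x}" by force
  moreover have "connected I" using assms(1) by (simp add: is_interval_connected)
  ultimately have "s islimpt I" using connected_imp_perfect \<open>s \<in> I\<close> by blast
  then show "at s within I \<noteq> bot" by (simp add: trivial_limit_within)
qed

lemma differentiable_on_has_vector_derivative: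
  assumes "f differentiable_on I" and "s \<in> I"
  shows "(f has_vector_derivative vector_derivative f (at s within I)) (at s within I)"
  using assms vector_derivative_works unfolding differentiable_on_def by blast

context
  fixes I :: "real set"
  assumes perfect: "\<forall>s\<in>I. at s within I \<noteq> bot"
begin

lemma vector_derivative_eqI:
  assumes "(f has_vector_derivative d) (at s within I)" and "s \<in> I"
  shows "vector_derivative f (at s within I) = d"
  using vector_derivative_within[OF bspec[OF perfect assms(2)] assms(1)] .

lemma times_differentiable_on_cong:
  assumes "times_differentiable_on m f I" and "\<And>s. s \<in> I \<Longrightarrow> f s = g s"
  shows "times_differentiable_on m g I"
  using assms
proof (induction m arbitrary: f g)
  case (Suc m)
  have d: "(g has_vector_derivative vector_derivative f (at s within I)) (at s within I)"
    if s: "s \<in> I" for s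
  proof (rule has_vector_derivative_transform[OF s])
    show "g t = f t" if "t \<in> I" for t using Suc.prems(2)[OF that] by simp
    show "(f has_vector_derivative vector_derivative f (at s within I)) (at s within I)"
      using Suc.prems(1) s by (simp add: differentiable_on_has_vector_derivative)
  qed
  have "g differentiable_on I"
    using d unfolding differentiable_on_def by (blast intro: differentiableI_vector)
  moreover have "times_differentiable_on m (\<lambda>s. vector_derivative g (at s within I)) I"
    using Suc.prems(1) vector_derivative_eqI[OF d]
    by (auto intro: Suc.IH[of "\<lambda>s. vector_derivative f (at s within I)"])
  ultimately show ?case by simp
qed simp

lemma times_differentiable_on_SucI:
  assumes "\<And>s. s \<in> I \<Longrightarrow> (f has_vector_derivative f' s) (at s within I)"
    and "times_differentiable_on m f' I"
  shows "times_differentiable_on (Suc m) f I"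
proof -
  have "f differentiable_on I"
    using assms(1) unfolding differentiable_on_def by (blast intro: differentiableI_vector)
  moreover have "times_differentiable_on m (\<lambda>s. vector_derivative f (at s within I)) I"
    using vector_derivative_eqI[OF assms(1)]
    by (auto intro: times_differentiable_on_cong[OF assms(2)])
  ultimately show ?thesis by simp
qed

lemma times_differentiable_on_Suc_imp:
  "times_differentiable_on (Suc m) f I \<Longrightarrow> times_differentiable_on m f I"
  by (induction m arbitrary: f) auto

lemma times_differentiable_on_add:
  assumes "times_differentiable_on m f I" and "times_differentiable_on m g I"
  shows "times_differentiable_on m (\<lambda>s. f s + g s) I"
  using assms
proof (induction m arbitrary: f g)
  case (Suc m)
  show ?case
  proof (rule times_differentiable_on_SucI)
    show "((\<lambda>s. f s + g s) has_vector_derivative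
        vector_derivative f (at s within I) + vector_derivative g (at s within I)) (at s within I)"
      if "s \<in> I" for s
      using Suc.prems that
      by (auto intro!: has_vector_derivative_add differentiable_on_has_vector_derivative)
    show "times_differentiable_on m
        (\<lambda>s. vector_derivative f (at s within I) + vector_derivative g (at s within I)) I"
      using Suc.prems by (auto intro: Suc.IH)
  qed
qed simp

lemma times_differentiable_on_bilinear:
  assumes "bounded_bilinear (\<beta> :: 'a::real_normed_vector \<Rightarrow> 'b::real_normed_vector \<Rightarrow> 'c::real_normed_vector)"
    and "times_differentiable_on m f I" and "times_differentiable_on m g I"
  shows "times_differentiable_on m (\<lambda>s. \<beta> (f s) (g s)) I"
  using assms(2,3)
proof (induction m arbitrary: f g)
  case (Suc m)
  let ?f' = "\<lambda>s. vector_derivative f (at s within I)"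
  let ?g' = "\<lambda>s. vector_derivative g (at s within I)"
  show ?case
  proof (rule times_differentiable_on_SucI)
    show "((\<lambda>s. \<beta> (f s) (g s)) has_vector_derivative \<beta> (f s) (?g' s) + \<beta> (?f' s) (g s))
        (at s within I)" if "s \<in> I" for s
      using Suc.prems that
      by (auto intro!: bounded_bilinear.has_vector_derivative[OF assms(1)]
            differentiable_on_has_vector_derivative)
    have f: "times_differentiable_on m f I" and g: "times_differentiable_on m g I"
      using Suc.prems[THEN times_differentiable_on_Suc_imp] by auto
    show "times_differentiable_on m (\<lambda>s. \<beta> (f s) (?g' s) + \<beta> (?f' s) (g s)) I"
      using Suc.prems f g by (auto intro!: times_differentiable_on_add Suc.IH)
  qed
qed simp

text \<open>The function \<open>r = 1 / \<parallel>f\<parallel>\<close> solves the differential equation \<open>r' = - \<langle>f', f\<rangle> r\<^sup>3\<close>, whose right-hand side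
  is as smooth as \<open>f'\<close> and \<open>r\<close> are; so the smoothness of \<open>r\<close> bootstraps up to that of \<open>f\<close>.\<close>

lemma times_differentiable_on_inverse_norm:
  fixes f :: "real \<Rightarrow> 'a::real_inner"
  assumes "times_differentiable_on m f I" and "\<forall>s\<in>I. f s \<noteq> 0"
  shows "times_differentiable_on m (\<lambda>s. inverse (norm (f s))) I"
  using assms(1)
proof (induction m)
  case (Suc m)
  let ?f' = "\<lambda>s. vector_derivative f (at s within I)"
  let ?r = "\<lambda>s. inverse (norm (f s))"
  show ?case
  proof (rule times_differentiable_on_SucI)
    fix s assume s: "s \<in> I"
    have d: "(f has_derivative (\<lambda>h. h *\<^sub>R ?f' s)) (at s within I)"
      using differentiable_on_has_vector_derivative[of f I s] Suc.prems s
      by (simp add: has_vector_derivative_def)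
    have n: "(norm has_derivative (\<lambda>h. h \<bullet> sgn (f s))) (at (f s))"
      using has_derivative_norm[of "f s"] assms(2) s by blast
    have "((\<lambda>s. norm (f s)) has_derivative (\<lambda>h. (h *\<^sub>R ?f' s) \<bullet> sgn (f s))) (at s within I)"
      using has_derivative_compose[OF d n] .
    then have "((\<lambda>s. norm (f s)) has_field_derivative (?f' s \<bullet> sgn (f s))) (at s within I)"
      unfolding has_field_derivative_def by (rule has_derivative_eq_rhs) (auto simp: fun_eq_iff)
    then have "(?r has_field_derivative
        - (inverse (norm (f s)) * (?f' s \<bullet> sgn (f s)) * inverse (norm (f s)))) (at s within I)"
      using assms(2) s by (intro DERIV_inverse') auto
    then show "(?r has_vector_derivative
        (- 1) * ((?f' s \<bullet> f s) * (?r s * (?r s * ?r s)))) (at s within I)"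
      unfolding has_real_derivative_iff_has_vector_derivative
      by (simp add: sgn_div_norm mult_ac)
  next
    have f: "times_differentiable_on m f I"
      using Suc.prems by (rule times_differentiable_on_Suc_imp)
    have const: "times_differentiable_on m (\<lambda>s. c :: real) I" for c
    proof (induction m arbitrary: c)
      case (Suc m)
      show ?case
        by (rule times_differentiable_on_SucI[OF has_vector_derivative_const Suc.IH])
    qed simp
    show "times_differentiable_on m (\<lambda>s. (- 1) * ((?f' s \<bullet> f s) * (?r s * (?r s * ?r s)))) I"
      using Suc.prems f Suc.IH[OF f]
      by (intro times_differentiable_on_bilinear[OF bounded_bilinear_mult]
          times_differentiable_on_bilinear[OF bounded_bilinear_inner] const) auto
  qed
qed simp

lemma times_differentiable_on_normalize:
  fixes f :: "real \<Rightarrow> 'a::real_inner"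
  assumes "times_differentiable_on m f I" and "\<forall>s\<in>I. f s \<noteq> 0"
  shows "times_differentiable_on m (\<lambda>s. f s /\<^sub>R norm (f s)) I"
  using times_differentiable_on_bilinear[OF bounded_bilinear_scaleR
      times_differentiable_on_inverse_norm[OF assms] assms(1)] .

end

section \<open>Regularity of the principal direction curves\<close>

lemma norm_principal_normal:
  assumes "vector_derivative (tangent I \<gamma>) (at s within I) \<noteq> 0"
  shows "norm (principal_normal I \<gamma> s) = 1"
  using assms by (simp add: principal_normal_def Let_def)

text \<open>The regularity that passes from the tangent of a principal direction curve to that of the
  next one, with \<open>m\<close> lowered by one: \<open>m\<close> counts the derivatives of \<open>T'\<close>, hence of the principal
  normal, so it is the number of steps that can still be taken.\<close>

definition regular_tangent :: "real set \<Rightarrow> nat \<Rightarrow> (real \<Rightarrow> real^3) \<Rightarrow> bool" where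
  "regular_tangent I m T \<longleftrightarrow> times_differentiable_on (Suc m) T I \<and>
     (\<forall>s\<in>I. norm (T s) = 1 \<and> vector_derivative T (at s within I) \<noteq> 0)"

context
  fixes I :: "real set"
  assumes perfect: "\<forall>s\<in>I. at s within I \<noteq> bot"
begin

lemma inner_constant_derivative:
  fixes f g :: "real \<Rightarrow> 'a::real_inner"
  assumes "f differentiable_on I" and "g differentiable_on I"
    and "\<forall>s\<in>I. f s \<bullet> g s = c" and "s \<in> I"
  shows "f s \<bullet> vector_derivative g (at s within I) + vector_derivative f (at s within I) \<bullet> g s = 0"
proof -
  have "((\<lambda>s. f s \<bullet> g s) has_vector_derivative
      f s \<bullet> vector_derivative g (at s within I) + vector_derivative f (at s within I) \<bullet> g s)
      (at s within I)"
    using assms(1,2,4)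
    by (intro bounded_bilinear.has_vector_derivative[OF bounded_bilinear_inner]
        differentiable_on_has_vector_derivative)
  then have d: "((\<lambda>s. c) has_vector_derivative
      f s \<bullet> vector_derivative g (at s within I) + vector_derivative f (at s within I) \<bullet> g s)
      (at s within I)"
    by (rule has_vector_derivative_transform[OF assms(4), rotated]) (simp add: assms(3))
  show ?thesis
    using vector_derivative_eqI[OF perfect d assms(4)]
      vector_derivative_eqI[OF perfect has_vector_derivative_const assms(4)] by metis
qed

text \<open>A tangent of constant length is orthogonal to its derivative, of which the principal normal
  is a multiple.\<close>

lemma tangent_orthogonal_principal_normal:
  assumes "tangent I \<gamma> differentiable_on I" and "\<forall>s\<in>I. norm (tangent I \<gamma> s) = 1"
  shows "\<forall>s\<in>I. tangent I \<gamma> s \<bullet> principal_normal I \<gamma> s = 0"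
proof
  fix s assume "s \<in> I"
  have "\<forall>t\<in>I. tangent I \<gamma> t \<bullet> tangent I \<gamma> t = 1"
    using assms(2) by (simp add: dot_square_norm)
  from inner_constant_derivative[OF assms(1,1) this \<open>s \<in> I\<close>]
  show "tangent I \<gamma> s \<bullet> principal_normal I \<gamma> s = 0"
    by (simp add: principal_normal_def Let_def inner_commute)
qed

lemma regular_tangent_cong:
  assumes "regular_tangent I m T" and eq: "\<And>s. s \<in> I \<Longrightarrow> T s = T\<^sub>1 s"
  shows "regular_tangent I m T\<^sub>1"
proof -
  have "times_differentiable_on (Suc m) T\<^sub>1 I"
    using assms times_differentiable_on_cong[OF perfect] unfolding regular_tangent_def by blast
  moreover have "vector_derivative T\<^sub>1 (at s within I) = vector_derivative T (at s within I)"
    if s: "s \<in> I" for s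
  proof (rule vector_derivative_eqI[OF perfect has_vector_derivative_transform[OF s] s])
    show "T\<^sub>1 t = T t" if "t \<in> I" for t using eq[OF that] by simp
    show "(T has_vector_derivative vector_derivative T (at s within I)) (at s within I)"
      using assms(1) s by (intro differentiable_on_has_vector_derivative) (auto simp: regular_tangent_def)
  qed
  ultimately show ?thesis using assms by (simp add: regular_tangent_def)
qed

text \<open>Differentiating \<open>\<langle>T, N\<rangle> = 0\<close> gives \<open>\<langle>T, N'\<rangle> = - \<langle>T', N\<rangle> = - \<parallel>T'\<parallel>\<close>, so \<open>N'\<close> does not vanish.\<close>

lemma regular_tangent_principal_normal:
  assumes "regular_tangent I (Suc m) (tangent I \<gamma>)"
  shows "regular_tangent I m (principal_normal I \<gamma>)"
proof -
  let ?T' = "\<lambda>s. vector_derivative (tangent I \<gamma>) (at s within I)"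
  have nz: "\<forall>s\<in>I. ?T' s \<noteq> 0"
    using assms by (simp add: regular_tangent_def)
  have unit: "\<forall>s\<in>I. norm (tangent I \<gamma> s) = 1"
    using assms by (simp add: regular_tangent_def)
  have dT: "tangent I \<gamma> differentiable_on I" and "times_differentiable_on (Suc m) ?T' I"
    using assms by (auto simp: regular_tangent_def)
  then have dN: "times_differentiable_on (Suc m) (principal_normal I \<gamma>) I"
    using times_differentiable_on_normalize[OF perfect _ nz] unfolding principal_normal_def[abs_def] Let_def
    by blast
  then have dN1: "principal_normal I \<gamma> differentiable_on I" by simp
  have "vector_derivative (principal_normal I \<gamma>) (at s within I) \<noteq> 0" if s: "s \<in> I" for s
  proof
    assume "vector_derivative (principal_normal I \<gamma>) (at s within I) = 0"
    then have "?T' s \<bullet> principal_normal I \<gamma> s = 0"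
      using inner_constant_derivative[OF dT dN1 tangent_orthogonal_principal_normal[OF dT unit] s]
      by simp
    then show False using nz s by (simp add: principal_normal_def Let_def)
  qed
  with dN nz show ?thesis by (simp add: regular_tangent_def norm_principal_normal)
qed

text \<open>A regular tangent is continuous, so that its primitive exists and has it as derivative.\<close>

lemma regular_tangent_primitive:
  assumes "is_interval I" and "regular_tangent I m T"
  shows "regular_tangent I m (tangent I (primitive I T))"
proof (rule regular_tangent_cong[OF assms(2)])
  have "continuous_on I T"
    using assms(2) by (auto simp: regular_tangent_def intro: differentiable_imp_continuous_on)
  then show "T s = tangent I (primitive I T) s" if "s \<in> I" for s
    unfolding tangent_def
    using vector_derivative_eqI[OF perfect primitive_has_vector_derivative[OF assms(1) _ that] that] by simp
qed

lemma principal_direction_curve_regular: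
  assumes "is_interval I" and "regular_tangent I (m + k) (tangent I \<gamma>)"
  shows "regular_tangent I m (tangent I (principal_direction_curve I \<gamma> k))"
  using assms(2)
proof (induction k arbitrary: m)
  case 0
  then show ?case using regular_tangent_primitive[OF assms(1)] by simp
next
  case (Suc k)
  then have "regular_tangent I (Suc m) (tangent I (principal_direction_curve I \<gamma> k))" by simp
  then show ?case
    by (simp add: regular_tangent_primitive[OF assms(1) regular_tangent_principal_normal])
qed

end

section \<open>Darboux vectors of slant helices\<close>

lemma orthonormal_cross3_expansion:
  fixes T N v :: "real^3"
  assumes "norm T = 1" and "norm N = 1" and "T \<bullet> N = 0"
  shows "v = (v \<bullet> T) *\<^sub>R T + (v \<bullet> N) *\<^sub>R N + (v \<bullet> cross3 T N) *\<^sub>R cross3 T N"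
proof -
  let ?B = "cross3 T N"
  define x where "x = v - ((v \<bullet> T) *\<^sub>R T + (v \<bullet> N) *\<^sub>R N + (v \<bullet> ?B) *\<^sub>R ?B)"
  have TN: "T \<bullet> T = 1" "N \<bullet> N = 1" "N \<bullet> T = 0"
    using assms by (simp_all add: dot_square_norm inner_commute)
  have "(norm ?B)\<^sup>2 = 1" using norm_cross_dot[of T N] assms by simp
  then have B: "?B \<bullet> ?B = 1" "norm ?B = 1" by (simp_all add: power2_norm_eq_inner norm_eq_1)
  have x: "x \<bullet> T = 0" "x \<bullet> N = 0" "x \<bullet> ?B = 0"
    unfolding x_def using TN B assms(3)
    by (simp_all add: inner_diff_left inner_add_left dot_cross_self)
  \<comment> \<open>By Lagrange's identity \<open>x\<close> is parallel to \<open>B\<close>; it is also orthogonal to \<open>B\<close>.\<close>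
  have "cross3 x ?B = 0" by (simp add: Lagrange x)
  then have "x = 0" using norm_cross_dot[of x ?B] x B by simp
  then show ?thesis by (simp add: x_def)
qed

text \<open>Lagrange's identity turns the equality case of the Cauchy--Schwarz inequality into algebra:
  \<open>(\<tau> p + \<kappa> q)\<^sup>2 + (\<tau> q - \<kappa> p)\<^sup>2 = (\<tau>\<^sup>2 + \<kappa>\<^sup>2) (p\<^sup>2 + q\<^sup>2)\<close> with \<open>p = \<langle>T, u\<rangle>\<close> and \<open>q = \<langle>B, u\<rangle>\<close>.\<close>

lemma slant_helix_darboux_inner_square:
  fixes T N N' u :: "real^3"
  defines "B \<equiv> cross3 T N"
  assumes "norm T = 1" and "norm N = 1" and "T \<bullet> N = 0" and "N' \<bullet> N = 0"
    and "norm u = 1" and "N' \<bullet> u = 0" and \<kappa>: "N' \<bullet> T = - \<kappa>" and \<tau>: "N' \<bullet> B = \<tau>"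
  shows "((\<tau> *\<^sub>R T + \<kappa> *\<^sub>R B) \<bullet> u)\<^sup>2 = (norm (\<tau> *\<^sub>R T + \<kappa> *\<^sub>R B))\<^sup>2 * (1 - (N \<bullet> u)\<^sup>2)"
proof -
  let ?p = "T \<bullet> u" and ?q = "B \<bullet> u"
  have parallel: "\<tau> * ?q - \<kappa> * ?p = 0"
  proof -
    have "N' = - \<kappa> *\<^sub>R T + \<tau> *\<^sub>R B"
      using orthonormal_cross3_expansion[OF assms(2-4), of N'] assms(5) \<kappa> \<tau> unfolding B_def by simp
    then have "N' \<bullet> u = - \<kappa> * ?p + \<tau> * ?q" by (simp add: inner_diff_left)
    then show ?thesis using \<open>N' \<bullet> u = 0\<close> by simp
  qed
  have "u \<bullet> u = ((u \<bullet> T) *\<^sub>R T + (u \<bullet> N) *\<^sub>R N + (u \<bullet> B) *\<^sub>R B) \<bullet> u"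
    unfolding B_def
    by (rule arg_cong[OF orthonormal_cross3_expansion[OF assms(2-4)], where f = "\<lambda>v. v \<bullet> u"])
  then have "u \<bullet> u = ?p\<^sup>2 + (N \<bullet> u)\<^sup>2 + ?q\<^sup>2"
    by (simp only: inner_add_left inner_scaleR_left power2_eq_square
        inner_commute[of u T] inner_commute[of u N] inner_commute[of u B])
  then have unit: "?p\<^sup>2 + ?q\<^sup>2 = 1 - (N \<bullet> u)\<^sup>2"
    using \<open>norm u = 1\<close> by (simp add: dot_square_norm)
  have "(norm B)\<^sup>2 = 1" using norm_cross_dot[of T N] assms(2-4) by (simp add: B_def)
  moreover have "T \<bullet> B = 0" by (simp add: B_def dot_cross_self)
  ultimately have "(norm (\<tau> *\<^sub>R T + \<kappa> *\<^sub>R B))\<^sup>2 = \<tau>\<^sup>2 + \<kappa>\<^sup>2"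
    using \<open>norm T = 1\<close>
    by (simp add: norm_add_Pythagorean orthogonal_def power_mult_distrib)
  moreover have "(\<tau> * ?p + \<kappa> * ?q)\<^sup>2 + (\<tau> * ?q - \<kappa> * ?p)\<^sup>2 = (\<tau>\<^sup>2 + \<kappa>\<^sup>2) * (?p\<^sup>2 + ?q\<^sup>2)"
    by algebra
  ultimately show ?thesis using parallel unit by (simp add: inner_add_left)
qed

lemma continuous_on_constant_square:
  fixes f :: "'a::topological_space \<Rightarrow> real"
  assumes "connected S" and "continuous_on S f" and "\<And>x. x \<in> S \<Longrightarrow> (f x)\<^sup>2 = K"
  shows "\<exists>c. \<forall>x\<in>S. f x = c"
proof -
  have "f ` S \<subseteq> {sqrt K, - sqrt K}" using assms(3) by (force simp: abs_if)
  then have "finite (f ` S)" by (rule finite_subset) simp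
  then have "f constant_on S" using continuous_finite_range_constant[OF assms(1,2)] by simp
  then show ?thesis by (simp add: constant_on_def)
qed

text \<open>The square of \<open>\<langle>W, u\<rangle>\<close> being constant, only a jump between its two square roots could make
  \<open>\<langle>W, u\<rangle>\<close> vary; continuity of the frame, the curvature and the torsion excludes it.\<close>

lemma slant_helix_darboux_inner_constant:
  assumes I: "is_interval I" "\<exists>a\<in>I. \<exists>b\<in>I. a < b"
    and frenet: "frenet_differentiable_on \<gamma> I"
    and T: "\<forall>s\<in>I. norm (tangent I \<gamma> s) = 1"
    and T': "\<forall>s\<in>I. vector_derivative (tangent I \<gamma>) (at s within I) \<noteq> 0"
    and u: "norm u = 1" "\<forall>s\<in>I. principal_normal I \<gamma> s \<bullet> u = c"
    and W: "\<forall>s\<in>I. norm (darboux I \<gamma> s) = \<omega>"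
  shows "\<exists>d. \<forall>s\<in>I. darboux I \<gamma> s \<bullet> u = d"
proof (rule continuous_on_constant_square)
  note perfect = at_within_interval_nontrivial[OF I]
  have diff: "tangent I \<gamma> differentiable_on I" "principal_normal I \<gamma> differentiable_on I"
    using frenet by (auto simp: frenet_differentiable_on_def)
  show "connected I" using I(1) by (simp add: is_interval_connected)
  show "continuous_on I (\<lambda>s. darboux I \<gamma> s \<bullet> u)"
    using frenet unfolding darboux_def frenet_differentiable_on_def
    by (intro continuous_intros differentiable_imp_continuous_on) auto
  show "(darboux I \<gamma> s \<bullet> u)\<^sup>2 = \<omega>\<^sup>2 * (1 - c\<^sup>2)" if s: "s \<in> I" for s
  proof -
    let ?N = "principal_normal I \<gamma>"
    let ?N' = "vector_derivative ?N (at s within I)"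
    note orth = tangent_orthogonal_principal_normal[OF perfect diff(1) T]
    have norm_N: "\<forall>t\<in>I. norm (?N t) = 1"
      using T' by (simp add: norm_principal_normal)
    then have "\<forall>t\<in>I. ?N t \<bullet> ?N t = 1"
      by (simp add: dot_square_norm)
    from inner_constant_derivative[OF perfect diff(2,2) this s]
    have "?N' \<bullet> ?N s = 0" by (simp add: inner_commute)
    moreover have "?N' \<bullet> u = 0"
      using inner_constant_derivative[OF perfect diff(2) differentiable_on_const u(2) s]
        vector_derivative_within[OF bspec[OF perfect s] has_vector_derivative_const, of u] by simp
    moreover have "?N' \<bullet> tangent I \<gamma> s = - curvature I \<gamma> s"
      using inner_constant_derivative[OF perfect diff orth s]
      by (simp add: curvature_def inner_commute)
    moreover have "?N' \<bullet> cross3 (tangent I \<gamma> s) (?N s) = torsion I \<gamma> s"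
      by (simp add: torsion_def binormal_def)
    ultimately show ?thesis
      using slant_helix_darboux_inner_square[OF bspec[OF T s] bspec[OF norm_N s] bspec[OF orth s] _ u(1)]
        W u(2) s
      by (simp add: darboux_def binormal_def)
  qed
qed

theorem corollary3:
  fixes I :: "real set" and \<gamma> :: "real \<Rightarrow> real^3" and n k :: nat and \<omega> :: real
  assumes "is_interval I" and "\<exists>a\<in>I. \<exists>b\<in>I. a < b"
    and "n \<ge> 1" and "1 \<le> k" and "k \<le> n"
    and "times_differentiable_on (n + 2) \<gamma> I"
    and "\<forall>s\<in>I. norm (vector_derivative \<gamma> (at s within I)) = 1"
    and "\<forall>s\<in>I. vector_derivative (\<lambda>t. vector_derivative \<gamma> (at t within I)) (at s within I) \<noteq> 0"
    and "frenet_differentiable_on (principal_direction_curve I \<gamma> k) I"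
    and "N_slant_helix I \<gamma> k"
    and "\<forall>s\<in>I. norm (darboux I (principal_direction_curve I \<gamma> k) s) = \<omega>"
  shows "N_constant_precession I \<gamma> k"
proof -
  let ?\<gamma>k = "principal_direction_curve I \<gamma> k"
  note perfect = at_within_interval_nontrivial[OF assms(1,2)]
  \<comment> \<open>\<open>T = \<gamma>'\<close> has \<open>n + 1\<close> derivatives, hence \<open>T'\<close> has \<open>n\<close>, of which the construction of \<open>\<gamma>\<^sub>k\<close> uses \<open>k\<close>.\<close>
  have "regular_tangent I ((n - k) + k) (tangent I \<gamma>)"
    using assms(5-8) by (simp add: regular_tangent_def tangent_def[abs_def])
  then have "regular_tangent I (n - k) (tangent I ?\<gamma>k)"
    by (rule principal_direction_curve_regular[OF perfect assms(1)])
  then have T: "\<forall>s\<in>I. norm (tangent I ?\<gamma>k s) = 1"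
    and T': "\<forall>s\<in>I. vector_derivative (tangent I ?\<gamma>k) (at s within I) \<noteq> 0"
    by (auto simp: regular_tangent_def)
  obtain u c where u: "norm u = 1" "\<forall>s\<in>I. principal_normal I ?\<gamma>k s \<bullet> u = c"
    using assms(10) unfolding N_slant_helix_def by blast
  obtain d where "\<forall>s\<in>I. darboux I ?\<gamma>k s \<bullet> u = d"
    using slant_helix_darboux_inner_constant[OF assms(1,2,9) T T' u assms(11)] by blast
  \<comment> \<open>If \<open>\<omega> = 0\<close>, the zero vector \<open>W\<^sub>k\<close> has by the convention \<open>x / 0 = 0\<close> the angle \<open>arccos 0\<close> with \<open>u\<close>.\<close>
  then have "\<forall>s\<in>I. vec_angle (darboux I ?\<gamma>k s) u = arccos (d / \<omega>)"
    using u(1) assms(11) by (simp add: vec_angle_def)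
  then show ?thesis unfolding N_constant_precession_def using u(1) assms(11) by blast
qed

end
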